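(* Let $m\ge 1$ and $n\geq 0$ be integers and let $\gamma_{n,m}^{\mathcal{IC}}$ be the number of integer compositions of $n$ having $\mathrm{mex}$ equal to $m$. If $n<\binom{m}{2}$, then $\gamma_{n,m}^{\mathcal{IC}}=0$. If $n=\binom{m}{2}+k$ with $k\ge 0$, then $$\gamma_{n,m}^{\mathcal{IC}}=\sum_{\substack{\alpha_1,\ldots,\alpha_k\in\mathbf{N},\ \alpha_m=0\\ \alpha_1+2\alpha_2+\cdots+k\alpha_k=k}}\frac{(m-1+\alpha_1+\cdots+\alpha_k)!}{\displaystyle\prod_{i=1}^{m-1}(\alpha_i+1)!\prod_{i=m+1}^{k}\alpha_i!}.$$
   Context: An integer composition of $n$ is a tuple $(\lambda_1,\ldots,\lambda_r)$, $r\ge 0$, of positive integers (its parts) with $\lambda_1+\cdots+\lambda_r=n$; the empty composition is the composition of $0$. The $\mathrm{mex}$ of a composition is the smallest positive integer that is not one of its parts. Here $\mathbf{N}=\{0,1,2,\ldots\}$. Conventions for the formula: $\alpha_i=0$ for all $i>k$ (in particular the condition $\alpha_m=0$ is a restriction only when $m\le k$), empty products equal $1$, and for $k=0$ the sum consists of the single summand with all $\alpha_i$ equal to $0$, i.e. it equals $(m-1)!$. *)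

theory Defs
  imports Complex_Main
begin

definition compositions :: "nat \<Rightarrow> nat list set" where
  "compositions n = {xs. (\<forall>x\<in>set xs. 1 \<le> x) \<and> sum_list xs = n}"

definition mex :: "nat list \<Rightarrow> nat" where
  "mex xs = (LEAST i. 1 \<le> i \<and> i \<notin> set xs)"

definition gamma_IC :: "nat \<Rightarrow> nat \<Rightarrow> nat" where
  "gamma_IC n m = card {xs \<in> compositions n. mex xs = m}"

text \<open>
  The tuples \<open>(\<alpha>\<^sub>1, \<dots>, \<alpha>\<^sub>k)\<close> indexing the sum, each encoded as the function on all of
  \<^typ>\<open>nat\<close> that extends it by 0 outside \<open>{1..k}\<close>. Thus \<open>\<alpha>\<^sub>i = 0\<close> for \<open>i > k\<close> is built in,
  and \<open>\<alpha>\<^sub>m = 0\<close> is a restriction only when \<open>m \<le> k\<close>.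
\<close>

definition index_tuples :: "nat \<Rightarrow> nat \<Rightarrow> (nat \<Rightarrow> nat) set" where
  "index_tuples m k =
     {\<alpha>. (\<forall>i. i \<notin> {1..k} \<longrightarrow> \<alpha> i = 0) \<and> \<alpha> m = 0 \<and> (\<Sum>i=1..k. i * \<alpha> i) = k}"

text \<open>
  Both sets are finite, so neither \<^const>\<open>card\<close> nor the sum takes its default value 0
  for infinite sets.
\<close>

lemma finite_compositions: "finite (compositions n)"
proof (rule finite_subset)
  have len: "length xs \<le> sum_list xs" if "\<forall>x\<in>set xs. 1 \<le> x" for xs :: "nat list"
    using that by (induction xs) auto
  show "compositions n \<subseteq> {xs. set xs \<subseteq> {..n} \<and> length xs \<le> n}"
    using len by (auto simp: compositions_def dest: member_le_sum_list)
  show "finite {xs. set xs \<subseteq> {..n} \<and> length xs \<le> n}"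
    by (rule finite_lists_length_le) simp
qed

lemma finite_index_tuples: "finite (index_tuples m k)"
proof (rule finite_subset)
  show "index_tuples m k \<subseteq>
      {\<alpha>. \<forall>i. (i \<in> {1..k} \<longrightarrow> \<alpha> i \<in> {..k}) \<and> (i \<notin> {1..k} \<longrightarrow> \<alpha> i = 0)}"
  proof
    fix \<alpha> assume a: "\<alpha> \<in> index_tuples m k"
    have "\<alpha> i \<le> k" if i: "i \<in> {1..k}" for i
    proof -
      have "\<alpha> i \<le> i * \<alpha> i" using i by simp
      also have "\<dots> \<le> (\<Sum>i=1..k. i * \<alpha> i)"
        by (rule member_le_sum[OF i]) auto
      also have "\<dots> = k" using a by (simp add: index_tuples_def)
      finally show ?thesis .
    qed
    then show "\<alpha> \<in> {\<alpha>. \<forall>i. (i \<in> {1..k} \<longrightarrow> \<alpha> i \<in> {..k}) \<and> (i \<notin> {1..k} \<longrightarrow> \<alpha> i = 0)}"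
      using a by (auto simp: index_tuples_def)
  qed
  show "finite {\<alpha>. \<forall>i. (i \<in> {1..k} \<longrightarrow> \<alpha> i \<in> {..k}) \<and> (i \<notin> {1..k} \<longrightarrow> \<alpha> i = (0::nat))}"
    by (rule finite_set_of_finite_funs) auto
qed

end

theory Submission
  imports Defs "HOL-Combinatorics.Multiset_Permutations"
begin

text \<open>
  Only the multiset of parts matters for the sum and the mex of a composition. Encode that multiset
  by its multiplicities \<open>c i\<close>. Having mex \<open>m\<close> means \<open>c i \<ge> 1\<close> for \<open>1 \<le> i < m\<close> and \<open>c m = 0\<close>, so one
  copy of each of \<open>1, \<dots>, m - 1\<close> is forced. These copies add up to \<open>m choose 2\<close>, and the excess
  \<open>\<alpha> i = c i - [1 \<le> i < m]\<close> is an arbitrary tuple with \<open>\<alpha> m = 0\<close> and weight \<open>\<Sum> i * \<alpha> i\<close> equal to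
  the rest \<open>k\<close> of the sum. The compositions with mex \<open>m\<close> are therefore partitioned by their excess
  (\<open>compositions_mex_eq_UN\<close>). The compositions with a given excess are the arrangements of one
  multiset, and their number is the multinomial coefficient (\<open>card_lists_with_counts\<close>) that
  appears as the summand. In particular the forced parts alone already sum to \<open>m choose 2\<close>, so no
  smaller \<open>n\<close> has a composition with mex \<open>m\<close>.
\<close>

text \<open>
  The lists are the permutations of the multiset with multiplicities \<open>c\<close>. The set \<open>S\<close> may exceed
  the support, since \<open>0! = 1\<close>; this allows one index range for all excess tuples.
\<close>

lemma card_lists_with_counts:
  fixes c :: "'a \<Rightarrow> nat"
  assumes "finite S" and supp: "\<And>i. i \<notin> S \<Longrightarrow> c i = 0"
  shows "real (card {xs. count_list xs = c}) = fact (\<Sum>i\<in>S. c i) / (\<Prod>i\<in>S. fact (c i))"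
proof -
  have "finite {i. c i > 0}"
    by (rule finite_subset[OF _ \<open>finite S\<close>]) (use supp in force)
  then have count: "count (Abs_multiset c) = c"
    by (simp add: Abs_multiset_inverse)
  define M where "M = Abs_multiset c"
  have count_M: "count M = c"
    using count by (simp add: M_def)
  have sub: "set_mset M \<subseteq> S"
    using supp by (metis count_M count_eq_zero_iff subsetI)
  have "{xs. count_list xs = c} = permutations_of_multiset M"
    by (auto simp: permutations_of_multiset_def multiset_eq_iff count_M fun_eq_iff count_mset)
  moreover have "size M = (\<Sum>i\<in>S. c i)"
    unfolding size_multiset_overloaded_eq count_M
    by (rule sum.mono_neutral_left[OF \<open>finite S\<close> sub]) (simp add: count_M not_in_iff)
  moreover have "(\<Prod>i\<in>set_mset M. fact (count M i)) = (\<Prod>i\<in>S. fact (c i) :: nat)"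
    unfolding count_M
    by (rule prod.mono_neutral_left[OF \<open>finite S\<close> sub]) (simp add: count_M not_in_iff)
  ultimately have "card {xs. count_list xs = c} * (\<Prod>i\<in>S. fact (c i)) = fact (\<Sum>i\<in>S. c i)"
    using card_permutations_of_multiset_aux[of M] by (simp add: mult.commute)
  then have "real (card {xs. count_list xs = c}) * (\<Prod>i\<in>S. fact (c i)) = fact (\<Sum>i\<in>S. c i)"
    by (metis (mono_tags, lifting) of_nat_fact of_nat_mult of_nat_prod prod.cong)
  moreover have "(\<Prod>i\<in>S. fact (c i) :: real) \<noteq> 0"
    using \<open>finite S\<close> by simp
  ultimately show ?thesis
    by (rule eq_divide_imp[rotated])
qed

lemma mex_eq_iff:
  assumes "m \<ge> 1"
  shows "mex xs = m \<longleftrightarrow> {1..<m} \<subseteq> set xs \<and> m \<notin> set xs"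
proof
  assume m: "mex xs = m"
  have "\<exists>i. 1 \<le> i \<and> i \<notin> set xs"
  proof -
    obtain i where "i \<notin> insert 0 (set xs)"
      using ex_new_if_finite[of "insert 0 (set xs)"] by auto
    then show ?thesis
      by (intro exI[of _ i]) auto
  qed
  then have "1 \<le> mex xs \<and> mex xs \<notin> set xs"
    unfolding mex_def by (rule LeastI_ex)
  moreover have "i \<in> set xs" if "1 \<le> i" "i < mex xs" for i
    using not_less_Least[of i "\<lambda>i. 1 \<le> i \<and> i \<notin> set xs"] that by (auto simp: mex_def)
  ultimately show "{1..<m} \<subseteq> set xs \<and> m \<notin> set xs"
    using m by auto
next
  assume R: "{1..<m} \<subseteq> set xs \<and> m \<notin> set xs"
  show "mex xs = m"
    unfolding mex_def
  proof (rule Least_equality)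
    show "1 \<le> m \<and> m \<notin> set xs"
      using assms R by blast
    show "m \<le> i" if "1 \<le> i \<and> i \<notin> set xs" for i
    proof (rule ccontr)
      assume "\<not> m \<le> i"
      then have "i \<in> {1..<m}"
        using that by simp
      then show False
        using R that by blast
    qed
  qed
qed

text \<open>
  Passing from the excess to the multiplicities by addition, and not back by truncated subtraction,
  makes the correspondence injective for all \<open>\<alpha>\<close>.
\<close>

definition with_forced :: "nat \<Rightarrow> (nat \<Rightarrow> nat) \<Rightarrow> nat \<Rightarrow> nat" where
  "with_forced m \<alpha> i = \<alpha> i + of_bool (i \<in> {1..<m})"

lemma with_forced_inject: "with_forced m \<alpha> = with_forced m \<beta> \<longleftrightarrow> \<alpha> = \<beta>"
  by (simp add: with_forced_def fun_eq_iff)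

text \<open>
  With the weight \<open>w i = i\<close> this gives the sum of a composition, with \<open>w i = 1\<close> its number of parts.
\<close>

lemma sum_with_forced:
  assumes "finite S" "{1..<m} \<subseteq> S"
  shows "(\<Sum>i\<in>S. w i * with_forced m \<alpha> i) = (\<Sum>i\<in>{1..<m}. w i) + (\<Sum>i\<in>S. w i * \<alpha> i)"
proof -
  have "(\<Sum>i\<in>S. w i * of_bool (i \<in> {1..<m})) = (\<Sum>i\<in>{1..<m}. w i)"
    using assms by (intro sum.mono_neutral_cong_right) auto
  then show ?thesis
    by (simp add: with_forced_def distrib_left sum.distrib)
qed

lemma sum_forced_parts: "(\<Sum>i\<in>{1..<m}. i) = m choose 2"
proof (induction m)
  case (Suc m)
  then show ?case
    by (cases m) (auto simp: numeral_2_eq_2)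
qed simp

lemma sum_list_with_forced:
  assumes "count_list xs = with_forced m \<alpha>"
    and "finite S" "\<And>i. i \<notin> S \<Longrightarrow> \<alpha> i = 0"
  shows "sum_list xs = (m choose 2) + (\<Sum>i\<in>S. i * \<alpha> i)"
proof -
  let ?T = "S \<union> {1..<m}"
  have "i \<in> ?T" if "i \<in> set xs" for i
  proof (rule ccontr)
    assume "i \<notin> ?T"
    then have "count_list xs i = 0"
      using assms(3)[of i] by (simp add: assms(1) with_forced_def)
    then show False
      using that by (simp add: count_list_0_iff)
  qed
  then have "sum_list (map (\<lambda>i. i) xs) = (\<Sum>i\<in>?T. count_list xs i * i)"
    using assms(2) by (intro sum_list_map_eq_sum_count2 subsetI) simp_all
  also have "\<dots> = (\<Sum>i\<in>?T. i * with_forced m \<alpha> i)"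
    by (simp add: assms(1) mult.commute)
  also have "\<dots> = (m choose 2) + (\<Sum>i\<in>?T. i * \<alpha> i)"
    using assms(2) by (subst sum_with_forced) (simp_all only: sum_forced_parts finite_Un finite_atLeastLessThan Un_upper2)
  also have "(\<Sum>i\<in>?T. i * \<alpha> i) = (\<Sum>i\<in>S. i * \<alpha> i)"
    using assms(2,3) by (intro sum.mono_neutral_right) auto
  finally show ?thesis
    by simp
qed

lemma mex_excess_exists:
  assumes "m \<ge> 1" "xs \<in> compositions n" "mex xs = m"
  obtains \<alpha> where "count_list xs = with_forced m \<alpha>" "\<alpha> m = 0" "\<alpha> 0 = 0"
    "\<And>i. i \<notin> set xs \<Longrightarrow> \<alpha> i = 0"
proof
  define \<alpha> where "\<alpha> i = count_list xs i - of_bool (i \<in> {1..<m})" for i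
  have forced: "{1..<m} \<subseteq> set xs" and m: "m \<notin> set xs"
    using assms mex_eq_iff by auto
  then have "count_list xs i > 0" if "i \<in> {1..<m}" for i
    using that by (metis bot_nat_0.not_eq_extremum count_list_0_iff subsetD)
  then show "count_list xs = with_forced m \<alpha>"
    by (force simp: fun_eq_iff with_forced_def \<alpha>_def of_bool_def)
  show "\<alpha> i = 0" if "i \<notin> set xs" for i
    using that by (simp add: \<alpha>_def count_list_0_iff)
  then show "\<alpha> m = 0" "\<alpha> 0 = 0"
    using m assms(2) by (auto simp: compositions_def)
qed

text \<open>
  An excess \<open>\<alpha>\<close> of weight \<open>k\<close> satisfies \<open>i * \<alpha> i \<le> k\<close> for every \<open>i\<close>, so it vanishes above \<open>k\<close>
  and is one of the index tuples; conversely, adding the forced parts to an index tuple yields the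
  multiplicities of compositions with the right sum, and \<open>\<alpha> m = 0\<close> makes their mex \<open>m\<close>.
\<close>

lemma compositions_mex_eq_UN:
  assumes "m \<ge> 1"
  shows "{xs \<in> compositions ((m choose 2) + k). mex xs = m} =
    (\<Union>\<alpha>\<in>index_tuples m k. {xs. count_list xs = with_forced m \<alpha>})" (is "?L = ?R")
proof (intro equalityI subsetI)
  fix xs assume "xs \<in> ?L"
  then have xs: "xs \<in> compositions ((m choose 2) + k)" "mex xs = m"
    by auto
  obtain \<alpha> where \<alpha>: "count_list xs = with_forced m \<alpha>" "\<alpha> m = 0" "\<alpha> 0 = 0"
    "\<And>i. i \<notin> set xs \<Longrightarrow> \<alpha> i = 0"
    using mex_excess_exists[OF assms xs] by blast
  have sum: "sum_list xs = (m choose 2) + k"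
    using xs(1) by (simp add: compositions_def)
  have weight: "(\<Sum>i\<in>set xs. i * \<alpha> i) = k"
    using sum_list_with_forced[OF \<alpha>(1) List.finite_set \<alpha>(4)] unfolding sum by simp
  have large: "\<alpha> i = 0" if "i > k" for i
  proof (rule ccontr)
    assume nz: "\<alpha> i \<noteq> 0"
    then have "i \<in> set xs"
      using \<alpha>(4)[of i] by (rule contrapos_np)
    then have "i * \<alpha> i \<le> k"
      unfolding weight[symmetric] by (intro member_le_sum) auto
    moreover have "i \<le> i * \<alpha> i"
      using nz by simp
    ultimately show False
      using that by linarith
  qed
  have supp: "\<alpha> i = 0" if "i \<notin> {1..k}" for i
    using that large \<alpha>(3) by (cases "i = 0") auto
  have "(\<Sum>i=1..k. i * \<alpha> i) = k"
    using sum_list_with_forced[OF \<alpha>(1) finite_atLeastAtMost supp] unfolding sum by simp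
  then have "\<alpha> \<in> index_tuples m k"
    using supp \<alpha>(2) by (simp add: index_tuples_def)
  then show "xs \<in> ?R"
    using \<alpha>(1) by blast
next
  fix xs assume "xs \<in> ?R"
  then obtain \<alpha> where "\<alpha> \<in> index_tuples m k" and count: "count_list xs = with_forced m \<alpha>"
    by blast
  then have supp: "\<And>i. i \<notin> {1..k} \<Longrightarrow> \<alpha> i = 0" and m: "\<alpha> m = 0"
    and weight: "(\<Sum>i=1..k. i * \<alpha> i) = k"
    by (auto simp: index_tuples_def)
  have mem: "i \<in> set xs \<longleftrightarrow> with_forced m \<alpha> i \<noteq> 0" for i
    by (metis count count_list_0_iff)
  have "0 \<notin> set xs"
    using supp[of 0] by (simp add: mem with_forced_def)
  then have "\<forall>x\<in>set xs. 1 \<le> x"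
    by (metis less_one not_le)
  moreover have "sum_list xs = (m choose 2) + k"
    using sum_list_with_forced[OF count finite_atLeastAtMost supp] weight by simp
  moreover have "mex xs = m"
    using m by (auto simp: mex_eq_iff[OF assms] mem with_forced_def)
  ultimately show "xs \<in> ?L"
    by (simp add: compositions_def)
qed

lemma gamma_IC_below_choose_two:
  assumes "m \<ge> 1" "n < m choose 2"
  shows "gamma_IC n m = 0"
proof -
  have False if xs: "xs \<in> compositions n" "mex xs = m" for xs
  proof -
    obtain \<alpha> where \<alpha>: "count_list xs = with_forced m \<alpha>" "\<And>i. i \<notin> set xs \<Longrightarrow> \<alpha> i = 0"
      using mex_excess_exists[OF assms(1) xs] by blast
    have "m choose 2 \<le> sum_list xs"
      using sum_list_with_forced[OF \<alpha>(1) List.finite_set \<alpha>(2)] by simp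
    then show False
      using xs(1) assms(2) by (simp add: compositions_def)
  qed
  then have "{xs \<in> compositions n. mex xs = m} = {}"
    by blast
  then show ?thesis
    unfolding gamma_IC_def by (simp only: card.empty)
qed

text \<open>
  The multinomial coefficient takes the form of the summand: below \<open>m\<close> each multiplicity is
  \<open>\<alpha> i + 1\<close>, above \<open>m\<close> it is \<open>\<alpha> i\<close>, and at \<open>m\<close> and beyond \<open>max m k\<close> it is 0 and contributes
  a factor 1.
\<close>

lemma card_lists_with_forced:
  assumes "m \<ge> 1" "\<alpha> \<in> index_tuples m k"
  shows "real (card {xs. count_list xs = with_forced m \<alpha>}) =
    fact (m - 1 + (\<Sum>i=1..k. \<alpha> i)) /
      ((\<Prod>i=1..m-1. fact (\<alpha> i + 1)) * (\<Prod>i=m+1..k. fact (\<alpha> i)))"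
proof -
  \<comment> \<open>A range that contains the forced parts and the support of \<open>\<alpha>\<close>, whichever of
    \<open>m\<close> and \<open>k\<close> is larger.\<close>
  let ?S = "{1..m + k}"
  have supp: "\<And>i. i \<notin> {1..k} \<Longrightarrow> \<alpha> i = 0" and m: "\<alpha> m = 0"
    using assms(2) by (auto simp: index_tuples_def)
  have "(\<Sum>i\<in>?S. with_forced m \<alpha> i) = m - 1 + (\<Sum>i\<in>?S. \<alpha> i)"
    using sum_with_forced[of ?S m "\<lambda>_. 1" \<alpha>] by (simp add: subset_iff)
  also have "(\<Sum>i\<in>?S. \<alpha> i) = (\<Sum>i=1..k. \<alpha> i)"
    using supp by (intro sum.mono_neutral_right) auto
  finally have size: "(\<Sum>i\<in>?S. with_forced m \<alpha> i) = m - 1 + (\<Sum>i=1..k. \<alpha> i)" .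
  have "?S = {1..m-1} \<union> {m..m+k}"
    using assms(1) by auto
  then have "(\<Prod>i\<in>?S. fact (with_forced m \<alpha> i) :: real) =
      (\<Prod>i=1..m-1. fact (with_forced m \<alpha> i)) * (\<Prod>i=m..m+k. fact (with_forced m \<alpha> i))"
    using assms(1) by (simp add: prod.union_disjoint)
  also have "(\<Prod>i=1..m-1. fact (with_forced m \<alpha> i) :: real) = (\<Prod>i=1..m-1. fact (\<alpha> i + 1))"
    by (rule prod.cong) (auto simp: with_forced_def)
  also have "(\<Prod>i=m..m+k. fact (with_forced m \<alpha> i) :: real) = (\<Prod>i=m+1..k. fact (\<alpha> i))"
  proof (rule prod.mono_neutral_cong_right)
    show "\<forall>i\<in>{m..m+k} - {m+1..k}. fact (with_forced m \<alpha> i) = (1 :: real)"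
    proof
      fix i assume i: "i \<in> {m..m+k} - {m+1..k}"
      then have "\<alpha> i = 0"
        using m supp by (cases "i = m") auto
      then show "fact (with_forced m \<alpha> i) = (1 :: real)"
        using i by (simp add: with_forced_def)
    qed
  qed (auto simp: with_forced_def)
  finally have parts: "(\<Prod>i\<in>?S. fact (with_forced m \<alpha> i) :: real) =
      (\<Prod>i=1..m-1. fact (\<alpha> i + 1)) * (\<Prod>i=m+1..k. fact (\<alpha> i))" .
  have "with_forced m \<alpha> i = 0" if "i \<notin> ?S" for i
    using that supp[of i] by (auto simp: with_forced_def)
  then have "real (card {xs. count_list xs = with_forced m \<alpha>}) =
      fact (\<Sum>i\<in>?S. with_forced m \<alpha> i) / (\<Prod>i\<in>?S. fact (with_forced m \<alpha> i))"
    by (rule card_lists_with_counts[OF finite_atLeastAtMost])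
  then show ?thesis
    unfolding size parts .
qed

theorem proposition4p2:
  fixes m n :: nat
  assumes "m \<ge> 1"
  shows "(n < m choose 2 \<longrightarrow> gamma_IC n m = 0) \<and>
    (\<forall>k. n = (m choose 2) + k \<longrightarrow>
      real (gamma_IC n m) =
        (\<Sum>\<alpha>\<in>index_tuples m k.
          fact (m - 1 + (\<Sum>i=1..k. \<alpha> i)) /
          ((\<Prod>i=1..m-1. fact (\<alpha> i + 1)) * (\<Prod>i=m+1..k. fact (\<alpha> i)))))"
proof (intro conjI impI allI)
  assume "n < m choose 2"
  then show "gamma_IC n m = 0"
    by (rule gamma_IC_below_choose_two[OF assms])
next
  fix k assume n: "n = (m choose 2) + k"
  let ?F = "\<lambda>\<alpha>. {xs. count_list xs = with_forced m \<alpha>}"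
  note UN = compositions_mex_eq_UN[OF assms, of k]
  have "finite (\<Union>\<alpha>\<in>index_tuples m k. ?F \<alpha>)"
    unfolding UN[symmetric] using finite_compositions by simp
  then have "\<forall>\<alpha>\<in>index_tuples m k. finite (?F \<alpha>)"
    by (intro ballI) (erule finite_subset[rotated], blast)
  moreover have "\<forall>\<alpha>\<in>index_tuples m k. \<forall>\<beta>\<in>index_tuples m k. \<alpha> \<noteq> \<beta> \<longrightarrow> ?F \<alpha> \<inter> ?F \<beta> = {}"
    by (auto simp: with_forced_inject)
  ultimately have "gamma_IC n m = (\<Sum>\<alpha>\<in>index_tuples m k. card (?F \<alpha>))"
    unfolding gamma_IC_def n UN by (intro card_UN_disjoint finite_index_tuples)
  then show "real (gamma_IC n m) =
        (\<Sum>\<alpha>\<in>index_tuples m k.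
          fact (m - 1 + (\<Sum>i=1..k. \<alpha> i)) /
          ((\<Prod>i=1..m-1. fact (\<alpha> i + 1)) * (\<Prod>i=m+1..k. fact (\<alpha> i))))"
    using card_lists_with_forced[OF assms] by simp
qed

end
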